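(* Let $P$ and $Q$ be probability distributions on a measurable space $(\mathcal{X},\mathcal{F})$. Then $D_1(P\|Q)=D(P\|Q)$, where $D_1(P\|Q)=\lim_{\alpha\uparrow1}D_\alpha(P\|Q)$ and $D(P\|Q)$ is the Kullback-Leibler divergence. Moreover, if $D(P\|Q)=\infty$ or there exists a $\beta>1$ such that $D_\beta(P\|Q)<\infty$, then also $$\lim_{\alpha\downarrow1}D_\alpha(P\|Q)=D(P\|Q).$$
   Context: Let $P,Q$ have densities $p,q$ with respect to a dominating $\sigma$-finite measure $\mu$ (whose choice is immaterial). Rényi divergence: for $\alpha\in(0,1)\cup(1,\infty)$, $D_\alpha(P\|Q)=\frac{1}{\alpha-1}\ln\int p^\alpha q^{1-\alpha}\,d\mu\in[0,\infty]$, where for $\alpha>1$ one reads $p^\alpha q^{1-\alpha}$ as $p^\alpha/q^{\alpha-1}$ with the conventions $0/0=0$ and $x/0=\infty$ for $x>0$. Kullback-Leibler divergence: $D(P\|Q)=\int p\ln\frac{p}{q}\,d\mu$, with the conventions $0\ln(0/q)=0$ and $p\ln(p/0)=\infty$ if $p>0$. *)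

theory Defs
  imports "HOL-Probability.Probability"
begin

definition ln_ennreal :: "ennreal \<Rightarrow> ereal" where
  "ln_ennreal x = (if x = 0 then -\<infinity> else if x = \<infinity> then \<infinity> else ereal (ln (enn2real x)))"

text \<open>
  In \<^typ>\<open>ennreal\<close>, \<open>0 / 0 = 0\<close> and \<open>x / 0 = \<infinity>\<close> for \<open>x > 0\<close>, so the division below follows the
  usual conventions for \<open>\<alpha> > 1\<close>. Only \<open>\<alpha>\<close> in \<open>(0,1)\<close> or \<open>(1,\<infinity>)\<close> is meaningful.
\<close>

definition renyi_integrand :: "real \<Rightarrow> real \<Rightarrow> real \<Rightarrow> ennreal" where
  "renyi_integrand \<alpha> a b =
    (if \<alpha> < 1 then ennreal (a powr \<alpha> * b powr (1 - \<alpha>))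
     else ennreal (a powr \<alpha>) / ennreal (b powr (\<alpha> - 1)))"

definition renyi_of_densities ::
    "'a measure \<Rightarrow> real \<Rightarrow> ('a \<Rightarrow> real) \<Rightarrow> ('a \<Rightarrow> real) \<Rightarrow> ereal" where
  "renyi_of_densities \<mu> \<alpha> p q =
    ereal (1 / (\<alpha> - 1)) * ln_ennreal (\<integral>\<^sup>+ x. renyi_integrand \<alpha> (p x) (q x) \<partial>\<mu>)"

definition KL_integrand :: "real \<Rightarrow> real \<Rightarrow> ereal" where
  "KL_integrand a b = (if a = 0 then 0 else if b = 0 then \<infinity> else ereal (a * ln (a / b)))"

text \<open>
  The integral of the extended-real integrand is the integral of its positive part minus that of
  its negative part (\<^const>\<open>e2ennreal\<close> maps negative values to 0). For probability densities the
  second integral is at most 1, because \<open>a * ln (b / a) \<le> b - a\<close>.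
\<close>

definition KL_of_densities :: "'a measure \<Rightarrow> ('a \<Rightarrow> real) \<Rightarrow> ('a \<Rightarrow> real) \<Rightarrow> ereal" where
  "KL_of_densities \<mu> p q =
    enn2ereal (\<integral>\<^sup>+ x. e2ennreal (KL_integrand (p x) (q x)) \<partial>\<mu>)
    - enn2ereal (\<integral>\<^sup>+ x. e2ennreal (- KL_integrand (p x) (q x)) \<partial>\<mu>)"

text \<open>
  As functions of \<open>P\<close> and \<open>Q\<close> alone, the divergences are defined with \<open>P + Q\<close> as dominating
  measure. The lemmas \<open>renyi_divergence_eq\<close> and \<open>KL_div_eq\<close> show that every other choice of
  dominating measure and densities gives the same values. The library's \<^const>\<open>KL_divergence\<close> is a
  real-valued Bochner integral (0 if the integral diverges), hence cannot express the value
  \<open>\<infinity>\<close>, and its first argument after the base is the reference measure.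
\<close>

definition sum_measure :: "'a measure \<Rightarrow> 'a measure \<Rightarrow> 'a measure" where
  "sum_measure P Q = measure_of (space P) (sets P) (\<lambda>A. emeasure P A + emeasure Q A)"

definition real_RN_deriv :: "'a measure \<Rightarrow> 'a measure \<Rightarrow> 'a \<Rightarrow> real" where
  "real_RN_deriv M N = (\<lambda>x. enn2real (RN_deriv M N x))"

definition renyi_divergence :: "real \<Rightarrow> 'a measure \<Rightarrow> 'a measure \<Rightarrow> ereal" where
  "renyi_divergence \<alpha> P Q =
    renyi_of_densities (sum_measure P Q) \<alpha>
      (real_RN_deriv (sum_measure P Q) P) (real_RN_deriv (sum_measure P Q) Q)"

definition KL_div :: "'a measure \<Rightarrow> 'a measure \<Rightarrow> ereal" where
  "KL_div P Q =
    KL_of_densities (sum_measure P Q)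
      (real_RN_deriv (sum_measure P Q) P) (real_RN_deriv (sum_measure P Q) Q)"

lemma space_sum_measure [simp]: "space (sum_measure P Q) = space P"
  by (simp add: sum_measure_def)

lemma sets_sum_measure [simp, measurable_cong]: "sets (sum_measure P Q) = sets P"
  by (simp add: sum_measure_def)

lemma emeasure_sum_measure:
  assumes "sets Q = sets P" and A: "A \<in> sets P"
  shows "emeasure (sum_measure P Q) A = emeasure P A + emeasure Q A"
  unfolding sum_measure_def
proof (rule emeasure_measure_of_sigma[OF _ _ _ A])
  show "sigma_algebra (space P) (sets P)"
    by (rule sets.sigma_algebra_axioms)
  show "positive (sets P) (\<lambda>A. emeasure P A + emeasure Q A)"
    by (simp add: positive_def)
  show "countably_additive (sets P) (\<lambda>A. emeasure P A + emeasure Q A)"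
  proof (rule countably_additiveI)
    fix B :: "nat \<Rightarrow> 'a set"
    assume B: "range B \<subseteq> sets P" "disjoint_family B"
    then have "range B \<subseteq> sets Q"
      using assms by simp
    then show "(\<Sum>i. emeasure P (B i) + emeasure Q (B i))
        = emeasure P (\<Union> (range B)) + emeasure Q (\<Union> (range B))"
      using B by (simp add: suminf_add[symmetric] suminf_emeasure)
  qed
qed

lemma renyi_integrand_scale:
  assumes "0 \<le> c" "0 \<le> a" "0 \<le> b" "0 < \<alpha>"
  shows "renyi_integrand \<alpha> (c * a) (c * b) = ennreal c * renyi_integrand \<alpha> a b"
proof (cases "c = 0")
  case True
  then show ?thesis by (simp add: renyi_integrand_def)
next
  case False
  with assms have c: "c > 0" by simp
  have *: "c powr \<alpha> = c * c powr (\<alpha> - 1)"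
    using c by (simp add: powr_diff)
  show ?thesis
  proof (cases "\<alpha> < 1")
    case True
    have "(c * a) powr \<alpha> * (c * b) powr (1 - \<alpha>)
        = (c powr \<alpha> * c powr (1 - \<alpha>)) * (a powr \<alpha> * b powr (1 - \<alpha>))"
      using assms by (simp add: powr_mult)
    also have "c powr \<alpha> * c powr (1 - \<alpha>) = c"
      using c by (simp add: powr_add[symmetric])
    finally show ?thesis
      using True assms by (simp add: renyi_integrand_def ennreal_mult)
  next
    case False
    show ?thesis
    proof (cases "b = 0")
      case True
      then show ?thesis
        using False c assms
        by (cases "a = 0")
          (simp_all add: renyi_integrand_def ennreal_divide_eq_top_iff ennreal_divide_zero
            ennreal_mult_top powr_mult)
    next
      case b: False
      with assms have "b > 0" by simp
      then show ?thesis
        using False c assms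
        by (simp add: renyi_integrand_def divide_ennreal powr_mult * ennreal_mult[symmetric])
    qed
  qed
qed

lemma KL_integrand_scale:
  assumes "0 \<le> c" "0 \<le> a" "0 \<le> b"
  shows "e2ennreal (KL_integrand (c * a) (c * b)) = ennreal c * e2ennreal (KL_integrand a b)"
    and "e2ennreal (- KL_integrand (c * a) (c * b)) = ennreal c * e2ennreal (- KL_integrand a b)"
proof -
  have r: "e2ennreal (ereal (c * x)) = ennreal c * e2ennreal (ereal x)" for x
    using assms(1) by (cases "0 \<le> x")
      (auto simp: e2ennreal_ereal ennreal_mult ennreal_neg mult_nonneg_nonpos)
  have s: "- ereal x = ereal (- x)" for x by simp
  have r': "e2ennreal (- ereal (c * x)) = ennreal c * e2ennreal (- ereal x)" for x
    using r[of "- x"] by simp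
  show "e2ennreal (KL_integrand (c * a) (c * b)) = ennreal c * e2ennreal (KL_integrand a b)"
    using assms r[of "a * ln (a / b)"]
    by (auto simp: KL_integrand_def ennreal_mult_top e2ennreal_infty mult.assoc)
  show "e2ennreal (- KL_integrand (c * a) (c * b)) = ennreal c * e2ennreal (- KL_integrand a b)"
    using assms r'[of "a * ln (a / b)"]
    by (auto simp: KL_integrand_def mult.assoc e2ennreal_neg)
qed

lemma measurable_renyi_integrand [measurable]:
  assumes [measurable]: "p \<in> borel_measurable M" "q \<in> borel_measurable M"
  shows "(\<lambda>x. renyi_integrand \<alpha> (p x) (q x)) \<in> borel_measurable M"
  by (cases "\<alpha> < 1")
    (simp_all add: renyi_integrand_def borel_measurable_divide_ennreal)

lemma measurable_KL_integrand [measurable]: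
  assumes [measurable]: "p \<in> borel_measurable M" "q \<in> borel_measurable M"
  shows "(\<lambda>x. KL_integrand (p x) (q x)) \<in> borel_measurable M"
  unfolding KL_integrand_def by measurable

lemma measurable_real_RN_deriv [measurable]: "real_RN_deriv M N \<in> borel_measurable M"
  unfolding real_RN_deriv_def by measurable

lemma real_RN_deriv_nonneg [simp]: "0 \<le> real_RN_deriv M N x"
  by (simp add: real_RN_deriv_def)

lemma density_real_RN_deriv:
  assumes "sigma_finite_measure M" "sigma_finite_measure N"
    and "absolutely_continuous M N" "sets N = sets M"
  shows "density M (\<lambda>x. ennreal (real_RN_deriv M N x)) = N"
proof -
  interpret sigma_finite_measure M by fact
  have "density M (\<lambda>x. ennreal (real_RN_deriv M N x)) = density M (RN_deriv M N)"
    using RN_deriv_finite[OF assms(2,3,4)]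
    by (intro density_cong) (auto simp: real_RN_deriv_def less_top)
  also have "\<dots> = N"
    using assms by (simp add: density_RN_deriv)
  finally show ?thesis .
qed

lemma finite_measure_sum_measure:
  assumes "finite_measure P" "finite_measure Q" "sets Q = sets P"
  shows "finite_measure (sum_measure P Q)"
proof (rule finite_measureI)
  have "emeasure (sum_measure P Q) (space P) = emeasure P (space P) + emeasure Q (space P)"
    using assms(3) by (rule emeasure_sum_measure) (rule sets.top)
  then show "emeasure (sum_measure P Q) (space (sum_measure P Q)) \<noteq> \<infinity>"
    using finite_measure.emeasure_finite[OF assms(1)] finite_measure.emeasure_finite[OF assms(2)]
    by simp
qed

lemma density_sum_measure:
  assumes "finite_measure P" "finite_measure Q" "sets Q = sets P"
  shows "density (sum_measure P Q) (\<lambda>x. ennreal (real_RN_deriv (sum_measure P Q) P x)) = P"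
    and "density (sum_measure P Q) (\<lambda>x. ennreal (real_RN_deriv (sum_measure P Q) Q x)) = Q"
proof -
  let ?M = "sum_measure P Q"
  have fin: "finite_measure ?M"
    using assms by (rule finite_measure_sum_measure)
  have sf: "sigma_finite_measure P" "sigma_finite_measure Q" "sigma_finite_measure ?M"
    using assms(1,2) fin by (simp_all only: finite_measure.axioms(1))
  have "emeasure P A = 0 \<and> emeasure Q A = 0" if "A \<in> null_sets ?M" for A
    using that emeasure_sum_measure[OF assms(3), of A] by (simp add: null_sets_def)
  then have ac: "absolutely_continuous ?M P" "absolutely_continuous ?M Q"
    using assms(3) unfolding absolutely_continuous_def
    by (auto simp: null_sets_def)
  show "density ?M (\<lambda>x. ennreal (real_RN_deriv ?M P x)) = P"
    using sf(3,1) ac(1) by (rule density_real_RN_deriv) simp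
  show "density ?M (\<lambda>x. ennreal (real_RN_deriv ?M Q x)) = Q"
    using sf(3,2) ac(2) by (rule density_real_RN_deriv) (simp add: assms(3))
qed

context
  fixes \<mu> P Q :: "'a measure" and p q :: "'a \<Rightarrow> real"
  assumes fin: "finite_measure P" "finite_measure Q"
    and meas [measurable]: "p \<in> borel_measurable \<mu>" "q \<in> borel_measurable \<mu>"
    and nonneg: "\<And>x. 0 \<le> p x" "\<And>x. 0 \<le> q x"
    and P: "P = density \<mu> (\<lambda>x. ennreal (p x))" and Q: "Q = density \<mu> (\<lambda>x. ennreal (q x))"
begin

private lemma sets_eq: "sets Q = sets P" "sets P = sets \<mu>"
  by (simp_all add: P Q)

private lemma sum_measure_eq: "sum_measure P Q = density \<mu> (\<lambda>x. ennreal (p x + q x))"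
proof (rule measure_eqI)
  fix A assume "A \<in> sets (sum_measure P Q)"
  then have A: "A \<in> sets \<mu>" by (simp add: P)
  then have "emeasure (sum_measure P Q) A = emeasure P A + emeasure Q A"
    by (intro emeasure_sum_measure) (simp_all add: P Q)
  also have "\<dots> = (\<integral>\<^sup>+ x. ennreal (p x) * indicator A x + ennreal (q x) * indicator A x \<partial>\<mu>)"
    using A by (simp add: P Q emeasure_density nn_integral_add)
  also have "\<dots> = emeasure (density \<mu> (\<lambda>x. ennreal (p x + q x))) A"
    using A nonneg by (simp add: emeasure_density ennreal_plus distrib_right)
  finally show "emeasure (sum_measure P Q) A = \<dots>" .
qed (simp add: P)

private lemma AE_density_eq:
  assumes "finite_measure N" "f \<in> borel_measurable \<mu>" "\<And>x. 0 \<le> f x"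
    and N: "N = density \<mu> (\<lambda>x. ennreal (f x))"
    and g: "g \<in> borel_measurable \<mu>" "\<And>x. 0 \<le> g x"
    and Ng: "density (sum_measure P Q) (\<lambda>x. ennreal (g x)) = N"
  shows "AE x in \<mu>. (p x + q x) * g x = f x"
proof -
  note [measurable] = assms(2) g(1)
  interpret N: finite_measure N by fact
  have eq: "density \<mu> (\<lambda>x. ennreal (f x)) = density \<mu> (\<lambda>x. ennreal ((p x + q x) * g x))"
    using Ng g(2) nonneg by (simp add: N sum_measure_eq density_density_eq ennreal_mult)
  have "(\<integral>\<^sup>+ x. ennreal (f x) \<partial>\<mu>) = emeasure N (space \<mu>)"
    by (simp add: N emeasure_density cong: nn_integral_cong)
  then have "(\<integral>\<^sup>+ x. ennreal (f x) \<partial>\<mu>) \<noteq> \<infinity>"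
    using N.emeasure_finite by simp
  then have "AE x in \<mu>. ennreal (f x) = ennreal ((p x + q x) * g x)"
    using eq by (subst (asm) finite_density_unique) auto
  then show ?thesis
    using assms(3) g(2) nonneg by (auto simp: ennreal_inj)
qed

private abbreviation "p' \<equiv> real_RN_deriv (sum_measure P Q) P"
private abbreviation "q' \<equiv> real_RN_deriv (sum_measure P Q) Q"

private lemma meas' [measurable]: "p' \<in> borel_measurable \<mu>" "q' \<in> borel_measurable \<mu>"
  using measurable_real_RN_deriv[of "sum_measure P Q"] sets_eq(2)
  by (auto simp: sum_measure_eq)

private lemma AE_scale: "AE x in \<mu>. (p x + q x) * p' x = p x \<and> (p x + q x) * q' x = q x"
  using AE_density_eq[OF fin(1) meas(1) nonneg(1) P meas'(1) _ density_sum_measure(1)]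
    AE_density_eq[OF fin(2) meas(2) nonneg(2) Q meas'(2) _ density_sum_measure(2)]
    fin sets_eq(1)
  by auto

private lemma nn_integral_scale:
  assumes [measurable]: "\<And>f g. f \<in> borel_measurable \<mu> \<Longrightarrow> g \<in> borel_measurable \<mu> \<Longrightarrow>
      (\<lambda>x. h (f x) (g x)) \<in> borel_measurable \<mu>"
    and h: "\<And>a b c :: real. 0 \<le> a \<Longrightarrow> 0 \<le> b \<Longrightarrow> 0 \<le> c \<Longrightarrow> h (c * a) (c * b) = ennreal c * h a b"
  shows "(\<integral>\<^sup>+ x. h (p' x) (q' x) \<partial>sum_measure P Q) = (\<integral>\<^sup>+ x. h (p x) (q x) \<partial>\<mu>)"
proof -
  have "(\<integral>\<^sup>+ x. h (p' x) (q' x) \<partial>sum_measure P Q)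
      = (\<integral>\<^sup>+ x. h (p' x) (q' x) \<partial>density \<mu> (\<lambda>x. ennreal (p x + q x)))"
    by (rule arg_cong2[where f = nn_integral, OF sum_measure_eq refl])
  also have "\<dots> = (\<integral>\<^sup>+ x. ennreal (p x + q x) * h (p' x) (q' x) \<partial>\<mu>)"
    by (rule nn_integral_density) measurable
  also have "\<dots> = (\<integral>\<^sup>+ x. h (p x) (q x) \<partial>\<mu>)"
  proof (rule nn_integral_cong_AE)
    show "AE x in \<mu>. ennreal (p x + q x) * h (p' x) (q' x) = h (p x) (q x)"
      using AE_scale
    proof eventually_elim
      case (elim x)
      have "ennreal (p x + q x) * h (p' x) (q' x) = h ((p x + q x) * p' x) ((p x + q x) * q' x)"
        using nonneg by (intro h[symmetric]) auto
      with elim show ?case by (simp only:)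
    qed
  qed
  finally show ?thesis .
qed

lemma renyi_divergence_eq:
  assumes "0 < \<alpha>"
  shows "renyi_divergence \<alpha> P Q = renyi_of_densities \<mu> \<alpha> p q"
proof -
  have "(\<integral>\<^sup>+ x. renyi_integrand \<alpha> (p' x) (q' x) \<partial>sum_measure P Q)
      = (\<integral>\<^sup>+ x. renyi_integrand \<alpha> (p x) (q x) \<partial>\<mu>)"
    by (rule nn_integral_scale[where h = "renyi_integrand \<alpha>"])
      (use assms in \<open>simp_all add: renyi_integrand_scale measurable_renyi_integrand\<close>)
  then show ?thesis
    by (simp add: renyi_divergence_def renyi_of_densities_def)
qed

lemma KL_div_eq: "KL_div P Q = KL_of_densities \<mu> p q"
proof -
  have "(\<integral>\<^sup>+ x. e2ennreal (KL_integrand (p' x) (q' x)) \<partial>sum_measure P Q)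
      = (\<integral>\<^sup>+ x. e2ennreal (KL_integrand (p x) (q x)) \<partial>\<mu>)"
    by (rule nn_integral_scale[where h = "\<lambda>a b. e2ennreal (KL_integrand a b)"])
      (auto simp: KL_integrand_scale)
  moreover have "(\<integral>\<^sup>+ x. e2ennreal (- KL_integrand (p' x) (q' x)) \<partial>sum_measure P Q)
      = (\<integral>\<^sup>+ x. e2ennreal (- KL_integrand (p x) (q x)) \<partial>\<mu>)"
    by (rule nn_integral_scale[where h = "\<lambda>a b. e2ennreal (- KL_integrand a b)"])
      (auto simp: KL_integrand_scale)
  ultimately show ?thesis
    by (simp add: KL_div_def KL_of_densities_def)
qed

end

end

theory Submission
  imports Defs "HOL-Real_Asymp.Real_Asymp"
begin

text \<open>
  Under \<open>P\<close>, the likelihood ratio \<open>W = q / p\<close> satisfies \<open>D\<^sub>\<alpha> = ln (E (W powr (1 - \<alpha>))) / (\<alpha> - 1)\<close> and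
  \<open>D = - E (ln W)\<close>. By Jensen's inequality and \<open>ln y \<le> y - 1\<close>,
  \<open>E (ln W) \<le> ln (E (W powr \<theta>)) / \<theta> \<le> E ((W powr \<theta> - 1) / \<theta>)\<close> for \<open>\<theta> > 0\<close>, and the right-hand side
  tends to \<open>E (ln W)\<close> as \<open>\<theta> \<down> 0\<close>, by dominated convergence if \<open>ln W\<close> is integrable and by Fatou's
  lemma if \<open>E (ln W) = - \<infinity>\<close>. For \<open>\<alpha> \<up> 1\<close> take \<open>\<theta> = 1 - \<alpha>\<close>. For \<open>\<alpha> \<down> 1\<close> and \<open>D < \<infinity>\<close>, apply the same limit
  to \<open>W powr (1 - \<beta>)\<close>, which is integrable because \<open>D\<^sub>\<beta> < \<infinity>\<close>. If \<open>D = \<infinity>\<close>, then \<open>D\<^sub>\<alpha> = \<infinity>\<close> for all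
  \<open>\<alpha> > 1\<close>.
\<close>

section \<open>Bounds for \<open>(w powr \<theta> - 1) / \<theta>\<close>, the difference quotient
  at exponent 0\<close>

text \<open>By Young's inequality with weights \<theta> and 1 - \<theta>,
  \<open>w powr \<theta>\<close> is at most \<open>\<theta> * w + (1 - \<theta>)\<close>. The upper
  bound is uniform in \<theta>, as domination and Fatou's lemma require.\<close>

lemma powr_minus_one_over_le:
  fixes w \<theta> :: real
  assumes "0 \<le> w" "0 < \<theta>" "\<theta> \<le> 1"
  shows "(w powr \<theta> - 1) / \<theta> \<le> w - 1"
proof (cases "w = 0")
  case True
  with assms show ?thesis by (simp add: field_simps)
next
  case False
  with assms have "w powr \<theta> * 1 powr (1 - \<theta>) \<le> \<theta> * w + (1 - \<theta>) * 1"
    by (intro Youngs_inequality_0) auto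
  then have "w powr \<theta> - 1 \<le> (w - 1) * \<theta>" by (simp add: algebra_simps)
  with assms show ?thesis by (simp add: pos_divide_le_eq)
qed

text \<open>This is \<open>1 + t \<le> exp t\<close> at \<open>t = \<theta> * ln w\<close>; it
  supplies the lower bound, again uniform in \<theta>.\<close>

lemma ln_le_powr_minus_one_over:
  fixes w \<theta> :: real
  assumes "0 < w" "0 < \<theta>"
  shows "ln w \<le> (w powr \<theta> - 1) / \<theta>"
proof -
  have "1 + \<theta> * ln w \<le> w powr \<theta>"
    using assms exp_ge_add_one_self[of "\<theta> * ln w"] by (simp add: powr_def)
  with assms show ?thesis by (simp add: field_simps)
qed

lemma tendsto_powr_minus_one_over:
  fixes w :: real
  assumes "0 < w"
  shows "((\<lambda>\<theta>. (w powr \<theta> - 1) / \<theta>) \<longlongrightarrow> ln w) (at_right 0)"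
  using assms by real_asymp

lemma powr_le_one_plus:
  fixes w \<theta> :: real
  assumes "0 \<le> w" "0 < \<theta>" "\<theta> \<le> 1"
  shows "w powr \<theta> \<le> 1 + w"
proof -
  have "(w powr \<theta> - 1) \<le> (w - 1) * \<theta>"
    using powr_minus_one_over_le[OF assms] assms by (simp add: pos_divide_le_eq)
  also have "\<dots> \<le> w" using assms mult_left_mono[of \<theta> 1 w] by (simp add: algebra_simps)
  finally show ?thesis by simp
qed

lemma ln_ennreal_ennreal: "0 < x \<Longrightarrow> ln_ennreal (ennreal x) = ereal (ln x)"
  by (simp add: ln_ennreal_def ennreal_eq_0_iff not_le)

text \<open>The usual \<open>ln x \<le> x - 1\<close>, extended to \<open>x = 0\<close>, where the
  left-hand side is -\<infinity>.\<close>

lemma ln_ennreal_le: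
  assumes "0 \<le> x"
  shows "ln_ennreal (ennreal x) \<le> ereal (x - 1)"
  using assms ln_le_minus_one[of x] by (cases "x = 0") (auto simp: ln_ennreal_ennreal, simp add: ln_ennreal_def)

section \<open>Limits of \<open>ln (E (W powr \<theta>)) / \<theta>\<close> as \<theta> decreases to
  0\<close>

lemma (in prob_space) integrable_powr_le_1:
  fixes W :: "'a \<Rightarrow> real"
  assumes "integrable M W" "\<And>x. 0 \<le> W x" "0 < \<theta>" "\<theta> \<le> 1"
  shows "integrable M (\<lambda>x. W x powr \<theta>)"
proof (rule Bochner_Integration.integrable_bound)
  show "integrable M (\<lambda>x. 1 + W x)" using assms by auto
  show "(\<lambda>x. W x powr \<theta>) \<in> borel_measurable M" using assms by auto
  show "AE x in M. norm (W x powr \<theta>) \<le> norm (1 + W x)"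
    using assms by (auto intro!: order_trans[OF powr_le_one_plus])
qed

text \<open>The quotient is squeezed between \<open>E (ln W)\<close> (Jensen) and the expected
  difference quotient (\<open>ln y \<le> y - 1\<close>), which converges to \<open>E (ln W)\<close>
  by dominated convergence. Positivity of the moment is recorded so that \<open>ln_ennreal\<close>
  can later be replaced by the real logarithm.\<close>

lemma (in prob_space) tendsto_ln_expectation_powr:
  fixes W :: "'a \<Rightarrow> real"
  assumes W: "integrable M W" "\<And>x. 0 \<le> W x"
    and pos: "AE x in M. 0 < W x" and lnW: "integrable M (\<lambda>x. ln (W x))"
  shows "((\<lambda>\<theta>. ln (expectation (\<lambda>x. W x powr \<theta>)) / \<theta>) \<longlongrightarrow> expectation (\<lambda>x. ln (W x))) (at_right 0)"
    and "\<And>\<theta>. 0 < \<theta> \<Longrightarrow> \<theta> \<le> 1 \<Longrightarrow> 0 < expectation (\<lambda>x. W x powr \<theta>)"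
proof -
  let ?E = "\<lambda>\<theta>. expectation (\<lambda>x. W x powr \<theta>)"
  let ?m = "expectation (\<lambda>x. ln (W x))"
  have [measurable]: "W \<in> borel_measurable M" using W by auto
  have int: "integrable M (\<lambda>x. W x powr \<theta>)" if "0 < \<theta>" "\<theta> \<le> 1" for \<theta>
    using W that by (rule integrable_powr_le_1)
  have jensen: "exp (\<theta> * ?m) \<le> ?E \<theta>" if \<theta>: "0 < \<theta>" "\<theta> \<le> 1" for \<theta>
  proof -
    \<comment> \<open>Jensen's inequality by a tangent line: the integrand is the tangent of
      \<open>exp\<close> at \<open>\<theta> * ?m\<close>, evaluated at
      \<open>\<theta> * ln (W x)\<close>. Its non-constant part has mean zero, and convexity puts it
      below \<open>W x powr \<theta>\<close>.\<close>
    have "exp (\<theta> * ?m) = expectation (\<lambda>x. exp (\<theta> * ?m) * (1 + \<theta> * ln (W x) - \<theta> * ?m))"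
      using lnW by (simp add: prob_space)
    also have "\<dots> \<le> ?E \<theta>"
    proof (rule integral_mono_AE)
      show "AE x in M. exp (\<theta> * ?m) * (1 + \<theta> * ln (W x) - \<theta> * ?m) \<le> W x powr \<theta>"
        using pos
      proof eventually_elim
        case (elim x)
        have "exp (\<theta> * ?m) * (1 + (\<theta> * ln (W x) - \<theta> * ?m)) \<le> exp (\<theta> * ?m) * exp (\<theta> * ln (W x) - \<theta> * ?m)"
          by (intro mult_left_mono exp_ge_add_one_self) auto
        also have "\<dots> = W x powr \<theta>"
          using elim by (simp add: powr_def flip: exp_add)
        finally show ?case by (simp add: algebra_simps)
      qed
    qed (use lnW int[OF \<theta>] in auto)
    finally show ?thesis .
  qed
  show Epos: "0 < ?E \<theta>" if "0 < \<theta>" "\<theta> \<le> 1" for \<theta>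
    using jensen[OF that] by (rule less_le_trans[OF exp_gt_zero])
  show "((\<lambda>\<theta>. ln (?E \<theta>) / \<theta>) \<longlongrightarrow> ?m) (at_right 0)"
  \<comment> \<open>Dominated convergence is a statement about sequences; \<open>b = 1\<close>
    confines them to exponents below 1, where the bounds hold.\<close>
  proof (rule tendsto_at_right_sequentially[where b = 1])
    fix S :: "nat \<Rightarrow> real"
    assume S: "\<And>n. 0 < S n" "\<And>n. S n < 1" "S \<longlonglongrightarrow> 0"
    have S1: "S n \<le> 1" for n using S(2)[of n] by simp
    have S0: "filterlim S (at_right 0) sequentially"
      using S by (intro tendsto_imp_filterlim_at_right) (auto intro: always_eventually)
    have "(\<lambda>n. expectation (\<lambda>x. (W x powr S n - 1) / S n)) \<longlonglongrightarrow> ?m"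
    proof (rule integral_dominated_convergence)
      \<comment> \<open>The difference quotient lies between \<open>ln (W x)\<close> and
        \<open>W x - 1\<close>, neither of which depends on \<open>n\<close>.\<close>
      show "integrable M (\<lambda>x. \<bar>ln (W x)\<bar> + \<bar>W x - 1\<bar>)" using W lnW by auto
      show "AE x in M. (\<lambda>n. (W x powr S n - 1) / S n) \<longlonglongrightarrow> ln (W x)"
        using pos by eventually_elim (rule filterlim_compose[OF tendsto_powr_minus_one_over S0])
      show "AE x in M. norm ((W x powr S n - 1) / S n) \<le> \<bar>ln (W x)\<bar> + \<bar>W x - 1\<bar>" for n
        using pos
      proof eventually_elim
        case (elim x)
        show ?case
          using ln_le_powr_minus_one_over[OF elim S(1)[of n]]
            powr_minus_one_over_le[OF W(2)[of x] S(1)[of n] S1] by auto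
      qed
    qed auto
    moreover have "expectation (\<lambda>x. (W x powr S n - 1) / S n) = (?E (S n) - 1) / S n" for n
      using int[OF S(1) S1[of n]] by (simp add: prob_space)
    ultimately have lim: "(\<lambda>n. (?E (S n) - 1) / S n) \<longlonglongrightarrow> ?m" by (simp only:)
    show "((\<lambda>n. ln (?E (S n)) / S n)) \<longlonglongrightarrow> ?m"
    proof (rule tendsto_sandwich[OF _ _ tendsto_const lim]; intro always_eventually allI)
      fix n
      have "S n * ?m \<le> ln (?E (S n))"
        using jensen[OF S(1) S1[of n]] Epos[OF S(1) S1[of n]] by (simp add: ln_ge_iff)
      then show "?m \<le> ln (?E (S n)) / S n"
        using S(1)[of n] by (simp add: field_simps)
      show "ln (?E (S n)) / S n \<le> (?E (S n) - 1) / S n"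
        using S(1)[of n] Epos[OF S(1) S1[of n]] by (intro divide_right_mono ln_le_minus_one) auto
    qed
  qed auto
qed

lemma KL_integrand_zero: "KL_integrand 0 b = 0"
  by (simp add: KL_integrand_def)

lemma KL_integrand_one:
  "KL_integrand 1 b = (if b = 0 then \<infinity> else ereal (- ln b))"
  by (simp add: KL_integrand_def ln_div)

text \<open>Fatou's lemma forces the expected difference quotients to -\<infinity>, and
  \<open>ln y \<le> y - 1\<close> passes this on to the logarithm. Since \<open>W\<close> may
  vanish, even almost surely, the moment can be 0; hence \<open>ln_ennreal\<close>, with value
  -\<infinity> there.\<close>

lemma (in prob_space) tendsto_ln_expectation_powr_infinite:
  fixes W :: "'a \<Rightarrow> real"
  assumes W: "integrable M W" "\<And>x. 0 \<le> W x"
    and inf: "(\<integral>\<^sup>+ x. e2ennreal (KL_integrand 1 (W x)) \<partial>M) = \<infinity>"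
  shows "((\<lambda>\<theta>. ereal (- 1 / \<theta>) * ln_ennreal (\<integral>\<^sup>+ x. ennreal (W x powr \<theta>) \<partial>M)) \<longlongrightarrow> \<infinity>) (at_right 0)"
proof (rule tendsto_at_right_sequentially[where b = 1])
  fix S :: "nat \<Rightarrow> real"
  assume S: "\<And>n. 0 < S n" "\<And>n. S n < 1" "S \<longlonglongrightarrow> 0"
  have S1: "S n \<le> 1" for n using S(2)[of n] by simp
  have S0: "filterlim S (at_right 0) sequentially"
    using S by (intro tendsto_imp_filterlim_at_right) (auto intro: always_eventually)
  have [measurable]: "W \<in> borel_measurable M" using W by auto
  let ?E = "\<lambda>\<theta>. expectation (\<lambda>x. W x powr \<theta>)"
  \<comment> \<open>The summand \<open>W x\<close> makes \<open>f n\<close> nonnegative, so that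
    Fatou's lemma applies; its expectation is finite and is subtracted again at the end.\<close>
  define f where "f n x = (1 - W x powr S n) / S n + W x" for n x
  have [measurable]: "f n \<in> borel_measurable M" for n
    unfolding f_def by measurable
  have int: "integrable M (\<lambda>x. W x powr S n)" for n
    using W S(1) S1 by (rule integrable_powr_le_1)
  have f_nonneg: "0 \<le> f n x" for n x
    using powr_minus_one_over_le[OF W(2)[of x] S(1)[of n] S1] S(1)[of n]
    by (simp add: f_def diff_divide_distrib)
  have f_int: "(\<integral>\<^sup>+ x. ennreal (f n x) \<partial>M) = ennreal ((1 - ?E (S n)) / S n + expectation W)" for n
  proof -
    have "(\<integral>\<^sup>+ x. ennreal (f n x) \<partial>M) = ennreal (expectation (f n))"
      using f_nonneg int W by (intro nn_integral_eq_integral) (auto simp: f_def[abs_def])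
    also have "expectation (f n) = (1 - ?E (S n)) / S n + expectation W"
      using int W by (simp add: f_def[abs_def] prob_space)
    finally show ?thesis .
  qed
  have pw: "e2ennreal (KL_integrand 1 (W x)) \<le> liminf (\<lambda>n. ennreal (f n x))" for x
  proof (cases "W x = 0")
    case True
    \<comment> \<open>Here \<open>0 powr S n = 0\<close>, so \<open>f n x = 1 / S n\<close>.\<close>
    have "filterlim (\<lambda>n. f n x) at_top sequentially"
      unfolding f_def using True
      by (auto intro!: filterlim_compose[OF _ S0]) real_asymp
    then have "(\<lambda>n. ennreal (f n x)) \<longlonglongrightarrow> \<infinity>"
      by (simp add: ennreal_tendsto_top_eq_at_top)
    then have "liminf (\<lambda>n. ennreal (f n x)) = \<infinity>"
      by (intro lim_imp_Liminf) auto
    then show ?thesis by simp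
  next
    case False
    then have pos: "0 < W x" using W(2)[of x] by simp
    have "(\<lambda>n. - ((W x powr S n - 1) / S n) + W x) \<longlonglongrightarrow> - ln (W x) + W x"
      by (intro tendsto_intros filterlim_compose[OF tendsto_powr_minus_one_over S0] pos)
    then have "(\<lambda>n. ennreal (f n x)) \<longlonglongrightarrow> ennreal (- ln (W x) + W x)"
      by (intro tendsto_ennrealI) (simp add: f_def diff_divide_distrib)
    then have "liminf (\<lambda>n. ennreal (f n x)) = ennreal (- ln (W x) + W x)"
      by (intro lim_imp_Liminf) auto
    then show ?thesis
      using False pos by (simp add: KL_integrand_one e2ennreal_ereal ennreal_leI)
  qed
  have "\<infinity> \<le> (\<integral>\<^sup>+ x. liminf (\<lambda>n. ennreal (f n x)) \<partial>M)"
    unfolding inf[symmetric] by (rule nn_integral_mono[OF pw])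
  also have "\<dots> \<le> liminf (\<lambda>n. \<integral>\<^sup>+ x. ennreal (f n x) \<partial>M)"
    by (rule nn_integral_liminf) measurable
  finally have liminf: "\<infinity> \<le> liminf (\<lambda>n. \<integral>\<^sup>+ x. ennreal (f n x) \<partial>M)" .
  also have "\<dots> \<le> limsup (\<lambda>n. \<integral>\<^sup>+ x. ennreal (f n x) \<partial>M)"
    by (rule Liminf_le_Limsup) simp
  finally have "(\<lambda>n. \<integral>\<^sup>+ x. ennreal (f n x) \<partial>M) \<longlonglongrightarrow> \<infinity>"
    using liminf by (intro Liminf_eq_Limsup) (simp_all add: top_unique)
  then have "filterlim (\<lambda>n. (1 - ?E (S n)) / S n + expectation W) at_top sequentially"
    by (simp add: f_int ennreal_tendsto_top_eq_at_top)
  then have "filterlim (\<lambda>n. - expectation W + ((1 - ?E (S n)) / S n + expectation W)) at_top sequentially"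
    by (intro filterlim_tendsto_add_at_top[OF tendsto_const])
  then have lim: "(\<lambda>n. ereal ((1 - ?E (S n)) / S n)) \<longlonglongrightarrow> \<infinity>"
    by (simp add: tendsto_PInfty_eq_at_top)
  show "(\<lambda>n. ereal (- 1 / S n) * ln_ennreal (\<integral>\<^sup>+ x. ennreal (W x powr S n) \<partial>M)) \<longlonglongrightarrow> \<infinity>"
  \<comment> \<open>The factor \<open>- 1 / S n\<close> is negative, so the upper bound
    \<open>ln y \<le> y - 1\<close> becomes a lower bound tending to \<infinity>; the upper bound is
    the constant \<infinity>.\<close>
  proof (rule tendsto_sandwich[OF _ _ lim tendsto_const]; intro always_eventually allI)
    fix n
    have "(\<integral>\<^sup>+ x. ennreal (W x powr S n) \<partial>M) = ennreal (?E (S n))"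
      using int by (intro nn_integral_eq_integral) auto
    moreover have "ln_ennreal (ennreal (?E (S n))) \<le> ereal (?E (S n) - 1)"
      by (intro ln_ennreal_le integral_nonneg_AE) auto
    ultimately have "ereal (- 1 / S n) * ereal (?E (S n) - 1)
        \<le> ereal (- 1 / S n) * ln_ennreal (\<integral>\<^sup>+ x. ennreal (W x powr S n) \<partial>M)"
      using S(1)[of n]
      by (cases "ln_ennreal (\<integral>\<^sup>+ x. ennreal (W x powr S n) \<partial>M)") (auto simp: divide_right_mono)
    moreover have "ereal (- 1 / S n) * ereal (?E (S n) - 1) = ereal ((1 - ?E (S n)) / S n)"
      using S(1)[of n] by (simp add: field_simps)
    ultimately show "ereal ((1 - ?E (S n)) / S n)
        \<le> ereal (- 1 / S n) * ln_ennreal (\<integral>\<^sup>+ x. ennreal (W x powr S n) \<partial>M)" by simp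
  qed simp
qed auto

section \<open>The two limits when the reference measure is the first distribution, with densities 1
  and \<open>W\<close>\<close>

lemma renyi_integrand_one_gt:
  assumes "1 < \<alpha>" "0 < b"
  shows "renyi_integrand \<alpha> 1 b = ennreal (b powr (1 - \<alpha>))"
proof -
  have "ennreal 1 / ennreal (b powr (\<alpha> - 1)) = ennreal (1 / b powr (\<alpha> - 1))"
    using assms by (intro divide_ennreal) auto
  also have "1 / b powr (\<alpha> - 1) = b powr (1 - \<alpha>)"
    using powr_minus_divide[of b "\<alpha> - 1"] by simp
  finally show ?thesis
    using assms by (simp add: renyi_integrand_def)
qed

text \<open>Since \<open>ln w \<le> w\<close>, the negative part has finite integral, so the
  positive part alone decides between the cases. If its integral is finite, the integrand is almost
  everywhere finite; this excludes \<open>W x = 0\<close>, and the two integrals are those of the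
  parts of \<open>- ln W\<close>.\<close>

lemma (in prob_space) KL_of_densities_one_cases:
  fixes W :: "'a \<Rightarrow> real"
  assumes W: "integrable M W" "\<And>x. 0 \<le> W x"
  obtains (finite) "AE x in M. 0 < W x" "integrable M (\<lambda>x. ln (W x))"
      "KL_of_densities M (\<lambda>_. 1) W = ereal (- expectation (\<lambda>x. ln (W x)))"
    | (infinite) "(\<integral>\<^sup>+ x. e2ennreal (KL_integrand 1 (W x)) \<partial>M) = \<infinity>"
      "KL_of_densities M (\<lambda>_. 1) W = \<infinity>"
proof -
  have [measurable]: "W \<in> borel_measurable M" using W by auto
  let ?P = "\<integral>\<^sup>+ x. e2ennreal (KL_integrand 1 (W x)) \<partial>M"
  let ?N = "\<integral>\<^sup>+ x. e2ennreal (- KL_integrand 1 (W x)) \<partial>M"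
  have "?N \<le> (\<integral>\<^sup>+ x. ennreal (W x) \<partial>M)"
  proof (rule nn_integral_mono)
    fix x
    show "e2ennreal (- KL_integrand 1 (W x)) \<le> ennreal (W x)"
      using W(2)[of x] ln_bound[of "W x"]
      by (auto simp: KL_integrand_one e2ennreal_neg e2ennreal_ereal intro: ennreal_leI)
  qed
  also have "\<dots> < \<infinity>"
    using W by (simp add: integrable_iff_bounded)
  finally have N: "?N < \<infinity>" .
  show thesis
  proof (cases "?P = \<infinity>")
    case True
    moreover have "KL_of_densities M (\<lambda>_. 1) W = \<infinity>"
      using True N by (cases ?N) (auto simp: KL_of_densities_def)
    ultimately show thesis by (rule infinite)
  next
    case False
    then have "AE x in M. e2ennreal (KL_integrand 1 (W x)) \<noteq> \<infinity>"
      by (intro nn_integral_PInf_AE) auto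
    then have pos: "AE x in M. 0 < W x"
    proof eventually_elim
      case (elim x)
      then show ?case using W(2)[of x] by (auto simp: KL_integrand_one le_less)
    qed
    have P_eq: "?P = (\<integral>\<^sup>+ x. ennreal (- ln (W x)) \<partial>M)"
      using pos by (intro nn_integral_cong_AE, eventually_elim)
        (auto simp: KL_integrand_one e2ennreal_ereal)
    have N_eq: "?N = (\<integral>\<^sup>+ x. ennreal (ln (W x)) \<partial>M)"
      using pos by (intro nn_integral_cong_AE, eventually_elim)
        (auto simp: KL_integrand_one e2ennreal_ereal)
    have int: "integrable M (\<lambda>x. ln (W x))"
      using False N by (simp add: real_integrable_def P_eq N_eq)
    have "KL_of_densities M (\<lambda>_. 1) W = ereal (- expectation (\<lambda>x. ln (W x)))"
      using False N real_lebesgue_integral_def[OF int]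
      by (cases ?P; cases ?N) (auto simp: KL_of_densities_def P_eq N_eq)
    with pos int show thesis by (rule finite)
  qed
qed

lemma renyi_of_densities_one_less:
  assumes "\<alpha> < 1"
  shows "renyi_of_densities M \<alpha> (\<lambda>_. 1) W
    = ereal (- 1 / (1 - \<alpha>)) * ln_ennreal (\<integral>\<^sup>+ x. ennreal (W x powr (1 - \<alpha>)) \<partial>M)"
proof -
  have "1 / (\<alpha> - 1) = - 1 / (1 - \<alpha>)"
    using assms by (simp add: divide_simps)
  then show ?thesis
    using assms by (simp add: renyi_of_densities_def renyi_integrand_def)
qed

text \<open>The substitution \<theta> = 1 - \<alpha> reduces the claim to the limits at 0, one for
  each case of the divergence.\<close>

lemma (in prob_space) tendsto_renyi_of_densities_one_left:
  fixes W :: "'a \<Rightarrow> real"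
  assumes W: "integrable M W" "\<And>x. 0 \<le> W x"
  shows "((\<lambda>\<alpha>. renyi_of_densities M \<alpha> (\<lambda>_. 1) W) \<longlongrightarrow> KL_of_densities M (\<lambda>_. 1) W) (at_left 1)"
proof -
  let ?R = "\<lambda>\<theta>. ereal (- 1 / \<theta>) * ln_ennreal (\<integral>\<^sup>+ x. ennreal (W x powr \<theta>) \<partial>M)"
  have "(?R \<longlongrightarrow> KL_of_densities M (\<lambda>_. 1) W) (at_right 0)"
    using W
  proof (cases rule: KL_of_densities_one_cases)
    case finite
    have "((\<lambda>\<theta>. ereal (- (ln (expectation (\<lambda>x. W x powr \<theta>)) / \<theta>)))
        \<longlongrightarrow> ereal (- expectation (\<lambda>x. ln (W x)))) (at_right 0)"
      by (intro tendsto_intros tendsto_ln_expectation_powr(1)[OF W finite(1,2)])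
    moreover have "\<forall>\<^sub>F \<theta> in at_right 0. ereal (- (ln (expectation (\<lambda>x. W x powr \<theta>)) / \<theta>)) = ?R \<theta>"
      using eventually_at_right_less[of "0::real"] eventually_at_right_real[OF zero_less_one]
    proof eventually_elim
      case (elim \<theta>)
      then have "(\<integral>\<^sup>+ x. ennreal (W x powr \<theta>) \<partial>M) = ennreal (expectation (\<lambda>x. W x powr \<theta>))"
        by (intro nn_integral_eq_integral integrable_powr_le_1[OF W]) auto
      with elim tendsto_ln_expectation_powr(2)[OF W finite(1,2), of \<theta>] show ?case
        by (simp add: ln_ennreal_ennreal)
    qed
    ultimately show ?thesis
      unfolding finite(3) by (rule Lim_transform_eventually)
  next
    case infinite
    then show ?thesis
      using tendsto_ln_expectation_powr_infinite[OF W] by simp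
  qed
  moreover have "filterlim (\<lambda>\<alpha>. 1 - \<alpha>) (at_right 0) (at_left (1::real))"
    by real_asymp
  ultimately have "((\<lambda>\<alpha>. ?R (1 - \<alpha>)) \<longlongrightarrow> KL_of_densities M (\<lambda>_. 1) W) (at_left 1)"
    by (rule filterlim_compose)
  then show ?thesis
    by (rule Lim_transform_eventually)
      (auto simp: eventually_at_filter renyi_of_densities_one_less)
qed

text \<open>Pointwise, \<open>- ln w \<le> w powr (1 - \<alpha>) / (\<alpha> - 1)\<close> for
  \<open>w > 0\<close>, again from \<open>1 + t \<le> exp t\<close>; at \<open>w = 0\<close> both
  integrands are \<infinity>. An infinite divergence thus makes the integral for every \<alpha> > 1
  infinite.\<close>

lemma (in prob_space) renyi_of_densities_one_infinite:
  fixes W :: "'a \<Rightarrow> real"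
  assumes [measurable]: "W \<in> borel_measurable M" and nonneg: "\<And>x. 0 \<le> W x"
    and inf: "(\<integral>\<^sup>+ x. e2ennreal (KL_integrand 1 (W x)) \<partial>M) = \<infinity>"
    and "1 < \<alpha>"
  shows "renyi_of_densities M \<alpha> (\<lambda>_. 1) W = \<infinity>"
proof -
  have "e2ennreal (KL_integrand 1 (W x)) \<le> ennreal (1 / (\<alpha> - 1)) * renyi_integrand \<alpha> 1 (W x)" for x
  proof (cases "W x = 0")
    case True
    then show ?thesis
      using \<open>1 < \<alpha>\<close> by (simp add: renyi_integrand_def KL_integrand_one ennreal_mult_top ennreal_divide_zero)
  next
    case False
    then have pos: "0 < W x" using nonneg[of x] by simp
    have "1 + (1 - \<alpha>) * ln (W x) \<le> W x powr (1 - \<alpha>)"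
      using pos exp_ge_add_one_self[of "(1 - \<alpha>) * ln (W x)"] by (simp add: powr_def)
    then have "- ln (W x) \<le> 1 / (\<alpha> - 1) * W x powr (1 - \<alpha>)"
      using \<open>1 < \<alpha>\<close> by (simp add: field_simps)
    then have "ennreal (- ln (W x)) \<le> ennreal (1 / (\<alpha> - 1)) * ennreal (W x powr (1 - \<alpha>))"
      using \<open>1 < \<alpha>\<close> by (subst ennreal_mult[symmetric]) (auto intro: ennreal_leI)
    then show ?thesis
      using pos \<open>1 < \<alpha>\<close>
      by (simp add: renyi_integrand_one_gt KL_integrand_one e2ennreal_ereal)
  qed
  then have "\<infinity> \<le> (\<integral>\<^sup>+ x. ennreal (1 / (\<alpha> - 1)) * renyi_integrand \<alpha> 1 (W x) \<partial>M)"
    unfolding infinity_ennreal_def[symmetric] inf[symmetric] by (rule nn_integral_mono)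
  also have "\<dots> = ennreal (1 / (\<alpha> - 1)) * (\<integral>\<^sup>+ x. renyi_integrand \<alpha> 1 (W x) \<partial>M)"
    by (rule nn_integral_cmult) measurable
  finally have "(\<integral>\<^sup>+ x. renyi_integrand \<alpha> 1 (W x) \<partial>M) = \<infinity>"
    by (simp add: top_unique ennreal_mult_eq_top_iff)
  then show ?thesis
    using \<open>1 < \<alpha>\<close> by (simp add: renyi_of_densities_def ln_ennreal_def)
qed

lemma (in prob_space) tendsto_renyi_of_densities_one_right:
  fixes W :: "'a \<Rightarrow> real"
  assumes W: "integrable M W" "\<And>x. 0 \<le> W x"
    and fin: "KL_of_densities M (\<lambda>_. 1) W = \<infinity> \<or> (\<exists>\<beta>>1. renyi_of_densities M \<beta> (\<lambda>_. 1) W < \<infinity>)"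
  shows "((\<lambda>\<alpha>. renyi_of_densities M \<alpha> (\<lambda>_. 1) W) \<longlongrightarrow> KL_of_densities M (\<lambda>_. 1) W) (at_right 1)"
  using W
proof (cases rule: KL_of_densities_one_cases)
  case infinite
  have "\<forall>\<^sub>F \<alpha> in at_right 1. \<infinity> = renyi_of_densities M \<alpha> (\<lambda>_. 1) W"
    using eventually_at_right_less[of "1::real"]
    by eventually_elim (use W infinite(1) in \<open>auto simp: renyi_of_densities_one_infinite\<close>)
  then show ?thesis
    unfolding infinite(2) by (rule Lim_transform_eventually[OF tendsto_const])
next
  case finite
  have [measurable]: "W \<in> borel_measurable M" using W by auto
  from fin finite(3) obtain \<beta> where \<beta>: "1 < \<beta>" "renyi_of_densities M \<beta> (\<lambda>_. 1) W < \<infinity>"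
    by auto
  \<comment> \<open>These choices give
    \<open>V x powr \<theta> \<alpha> = W x powr (1 - \<alpha>)\<close> for \<open>W x > 0\<close>,
    and \<alpha> in (1, \<beta>) corresponds to exponents in (0, 1). The limit at 0 thus applies to
    \<open>V\<close> in place of \<open>W\<close>.\<close>
  define V where "V x = W x powr (1 - \<beta>)" for x
  define \<theta> where "\<theta> \<alpha> = (\<alpha> - 1) / (\<beta> - 1)" for \<alpha>
  have [measurable]: "V \<in> borel_measurable M" unfolding V_def by measurable
  have H_eq: "(\<integral>\<^sup>+ x. renyi_integrand \<alpha> 1 (W x) \<partial>M) = (\<integral>\<^sup>+ x. ennreal (V x powr \<theta> \<alpha>) \<partial>M)"
    if "1 < \<alpha>" for \<alpha>
  proof (rule nn_integral_cong_AE)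
    show "AE x in M. renyi_integrand \<alpha> 1 (W x) = ennreal (V x powr \<theta> \<alpha>)"
      using finite(1)
    proof eventually_elim
      case (elim x)
      have "(1 - \<beta>) * \<theta> \<alpha> = 1 - \<alpha>"
        using \<beta>(1) by (simp add: \<theta>_def field_simps)
      with elim that show ?case
        by (simp add: V_def powr_powr renyi_integrand_one_gt)
    qed
  qed
  \<comment> \<open>The exponent at \<beta> is 1, so the integral defining the divergence of order
    \<beta> is that of \<open>V\<close>; were it infinite, the divergence would be too.\<close>
  have V: "integrable M V" "0 \<le> V x" for x
  proof -
    have "\<theta> \<beta> = 1" using \<beta>(1) by (simp add: \<theta>_def)
    have "(\<integral>\<^sup>+ x. renyi_integrand \<beta> 1 (W x) \<partial>M) \<noteq> \<infinity>"
      using \<beta> by (auto simp: renyi_of_densities_def ln_ennreal_def)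
    then show "integrable M V"
      using H_eq[OF \<beta>(1)] \<open>\<theta> \<beta> = 1\<close> by (simp add: integrable_iff_bounded V_def less_top)
  qed (simp add: V_def)
  have pos: "AE x in M. 0 < V x"
    using finite(1) by eventually_elim (simp add: V_def)
  have ln_V: "ln (V x) = (1 - \<beta>) * ln (W x)" for x
    by (simp add: V_def ln_powr)
  have lnV: "integrable M (\<lambda>x. ln (V x))"
    using finite(2) by (simp add: ln_V)
  have "filterlim \<theta> (at_right 0) (at_right 1)"
    unfolding \<theta>_def using \<beta>(1) by real_asymp
  then have "((\<lambda>\<alpha>. ln (expectation (\<lambda>x. V x powr \<theta> \<alpha>)) / \<theta> \<alpha>) \<longlongrightarrow> expectation (\<lambda>x. ln (V x))) (at_right 1)"
    by (rule filterlim_compose[OF tendsto_ln_expectation_powr(1)[OF V pos lnV]])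
  \<comment> \<open>Dividing by \<open>\<beta> - 1\<close> turns
    \<open>1 / \<theta> \<alpha>\<close> into \<open>1 / (\<alpha> - 1)\<close>, and the limit into
    \<open>- E (ln W)\<close>, because \<open>ln V = (1 - \<beta>) * ln W\<close>.\<close>
  then have "((\<lambda>\<alpha>. ereal (ln (expectation (\<lambda>x. V x powr \<theta> \<alpha>)) / \<theta> \<alpha> / (\<beta> - 1)))
      \<longlongrightarrow> ereal (expectation (\<lambda>x. ln (V x)) / (\<beta> - 1))) (at_right 1)"
    using \<beta>(1) by (intro tendsto_intros) auto
  moreover have "expectation (\<lambda>x. ln (V x)) / (\<beta> - 1) = - expectation (\<lambda>x. ln (W x))"
    using \<beta>(1) finite(2) by (simp add: ln_V field_simps)
  moreover have "\<forall>\<^sub>F \<alpha> in at_right 1. ereal (ln (expectation (\<lambda>x. V x powr \<theta> \<alpha>)) / \<theta> \<alpha> / (\<beta> - 1))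
      = renyi_of_densities M \<alpha> (\<lambda>_. 1) W"
    using eventually_at_right_real[OF \<beta>(1)]
  proof eventually_elim
    case (elim \<alpha>)
    then have \<theta>: "0 < \<theta> \<alpha>" "\<theta> \<alpha> \<le> 1" and [simp]: "1 < \<alpha>"
      by (auto simp: \<theta>_def)
    have "(\<integral>\<^sup>+ x. ennreal (V x powr \<theta> \<alpha>) \<partial>M) = ennreal (expectation (\<lambda>x. V x powr \<theta> \<alpha>))"
      by (intro nn_integral_eq_integral integrable_powr_le_1[OF V \<theta>]) auto
    then have "renyi_of_densities M \<alpha> (\<lambda>_. 1) W
        = ereal (1 / (\<alpha> - 1)) * ereal (ln (expectation (\<lambda>x. V x powr \<theta> \<alpha>)))"
      using tendsto_ln_expectation_powr(2)[OF V pos lnV \<theta>]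
      by (simp add: renyi_of_densities_def H_eq ln_ennreal_ennreal)
    then show ?case
      using \<beta>(1) by (simp add: \<theta>_def)
  qed
  ultimately show ?thesis
    unfolding finite(3) by (auto intro: Lim_transform_eventually)
qed

section \<open>Change of reference measure to the first distribution\<close>

text \<open>Homogeneity of degree one gives \<open>p * h 1 (q / p) = h p q\<close> where
  \<open>p > 0\<close>. Where \<open>p = 0\<close> both sides vanish, the right-hand one by
  \<open>h0\<close>, so the value of \<open>q / 0\<close> is immaterial.\<close>

lemma nn_integral_density_ratio:
  fixes p q :: "'a \<Rightarrow> real" and h :: "real \<Rightarrow> real \<Rightarrow> ennreal"
  assumes [measurable]: "p \<in> borel_measurable M" "q \<in> borel_measurable M"
      "(\<lambda>x. h 1 (q x / p x)) \<in> borel_measurable M"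
    and nonneg: "\<And>x. 0 \<le> p x" "\<And>x. 0 \<le> q x"
    and h0: "\<And>b. h 0 b = 0"
    and h: "\<And>a b c. 0 \<le> c \<Longrightarrow> 0 \<le> a \<Longrightarrow> 0 \<le> b \<Longrightarrow> h (c * a) (c * b) = ennreal c * h a b"
  shows "(\<integral>\<^sup>+ x. h 1 (q x / p x) \<partial>density M (\<lambda>x. ennreal (p x))) = (\<integral>\<^sup>+ x. h (p x) (q x) \<partial>M)"
proof -
  have "(\<integral>\<^sup>+ x. h 1 (q x / p x) \<partial>density M (\<lambda>x. ennreal (p x)))
      = (\<integral>\<^sup>+ x. ennreal (p x) * h 1 (q x / p x) \<partial>M)"
    by (rule nn_integral_density) measurable
  also have "\<dots> = (\<integral>\<^sup>+ x. h (p x) (q x) \<partial>M)"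
  proof (rule nn_integral_cong)
    fix x
    show "ennreal (p x) * h 1 (q x / p x) = h (p x) (q x)"
      using h[of "p x" 1 "q x / p x"] nonneg[of x] by (cases "p x = 0") (auto simp: h0)
  qed
  finally show ?thesis .
qed

lemma
  fixes p q :: "'a \<Rightarrow> real"
  assumes [measurable]: "p \<in> borel_measurable M" "q \<in> borel_measurable M"
    and nonneg: "\<And>x. 0 \<le> p x" "\<And>x. 0 \<le> q x"
  shows renyi_of_densities_ratio: "0 < \<alpha> \<Longrightarrow>
      renyi_of_densities (density M (\<lambda>x. ennreal (p x))) \<alpha> (\<lambda>_. 1) (\<lambda>x. q x / p x)
        = renyi_of_densities M \<alpha> p q"
    and KL_of_densities_ratio:
      "KL_of_densities (density M (\<lambda>x. ennreal (p x))) (\<lambda>_. 1) (\<lambda>x. q x / p x)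
        = KL_of_densities M p q"
proof -
  show "renyi_of_densities (density M (\<lambda>x. ennreal (p x))) \<alpha> (\<lambda>_. 1) (\<lambda>x. q x / p x)
      = renyi_of_densities M \<alpha> p q" if "0 < \<alpha>"
    unfolding renyi_of_densities_def
    by (subst nn_integral_density_ratio[where h = "renyi_integrand \<alpha>"])
      (use that nonneg in \<open>auto simp: renyi_integrand_scale, auto simp: renyi_integrand_def\<close>)
  show "KL_of_densities (density M (\<lambda>x. ennreal (p x))) (\<lambda>_. 1) (\<lambda>x. q x / p x)
      = KL_of_densities M p q"
    unfolding KL_of_densities_def
    using nn_integral_density_ratio[where h = "\<lambda>a b. e2ennreal (KL_integrand a b)", OF assms(1,2) _ nonneg]
      nn_integral_density_ratio[where h = "\<lambda>a b. e2ennreal (- KL_integrand a b)", OF assms(1,2) _ nonneg]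
    by (simp add: KL_integrand_scale KL_integrand_zero)
qed

theorem theorem5:
  fixes P Q :: "'a measure"
  assumes "prob_space P" and "prob_space Q" and "sets Q = sets P"
  shows "((\<lambda>\<alpha>. renyi_divergence \<alpha> P Q) \<longlongrightarrow> KL_div P Q) (at_left 1)
    \<and> (KL_div P Q = \<infinity> \<or> (\<exists>\<beta>>1. renyi_divergence \<beta> P Q < \<infinity>) \<longrightarrow>
        ((\<lambda>\<alpha>. renyi_divergence \<alpha> P Q) \<longlongrightarrow> KL_div P Q) (at_right 1))"
proof -
  interpret P: prob_space P by fact
  interpret Q: prob_space Q by fact
  let ?M = "sum_measure P Q"
  define p where "p = real_RN_deriv ?M P"
  define q where "q = real_RN_deriv ?M Q"
  \<comment> \<open>The likelihood ratio, equal to 0 where \<open>p x = 0\<close>, which is a null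
    set of \<open>P\<close>.\<close>
  define W where "W x = q x / p x" for x
  have [measurable]: "p \<in> borel_measurable ?M" "q \<in> borel_measurable ?M"
    by (simp_all add: p_def q_def)
  have nonneg: "0 \<le> p x" "0 \<le> q x" for x
    by (simp_all add: p_def q_def)
  have P: "density ?M (\<lambda>x. ennreal (p x)) = P" and Q: "density ?M (\<lambda>x. ennreal (q x)) = Q"
    unfolding p_def q_def
    using density_sum_measure[OF P.finite_measure_axioms Q.finite_measure_axioms assms(3)] by auto
  have renyi: "renyi_divergence \<alpha> P Q = renyi_of_densities P \<alpha> (\<lambda>_. 1) W" if "0 < \<alpha>" for \<alpha>
    using renyi_of_densities_ratio[of p ?M q, OF _ _ nonneg that]
    by (simp add: P renyi_divergence_def p_def[symmetric] q_def[symmetric] W_def[abs_def])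
  have KL: "KL_div P Q = KL_of_densities P (\<lambda>_. 1) W"
    using KL_of_densities_ratio[of p ?M q, OF _ _ nonneg]
    by (simp add: P KL_div_def p_def[symmetric] q_def[symmetric] W_def[abs_def])
  have W_nonneg: "0 \<le> W x" for x
    using nonneg[of x] by (simp add: W_def)
  have "W \<in> borel_measurable ?M"
    unfolding W_def by measurable
  then have [measurable]: "W \<in> borel_measurable P"
    by (simp cong: measurable_cong_sets)
  have "(\<integral>\<^sup>+ x. ennreal (W x) \<partial>P) = (\<integral>\<^sup>+ x. ennreal (p x) * ennreal (W x) \<partial>?M)"
    by (subst P[symmetric], subst nn_integral_density) (simp_all add: W_def)
  \<comment> \<open>Only an inequality: the mass that \<open>Q\<close> puts on the set where
    \<open>p\<close> vanishes is lost.\<close>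
  also have "\<dots> \<le> (\<integral>\<^sup>+ x. ennreal (q x) \<partial>?M)"
    using nonneg by (intro nn_integral_mono) (simp add: W_def ennreal_mult'[symmetric])
  also have "\<dots> = emeasure (density ?M (\<lambda>x. ennreal (q x))) (space ?M)"
    by (subst emeasure_density) (auto intro!: nn_integral_cong)
  also have "\<dots> < \<infinity>"
    by (simp add: Q less_top[symmetric])
  finally have W: "integrable P W"
    using W_nonneg by (simp add: integrable_iff_bounded)
  \<comment> \<open>The two expressions are known to agree for \<alpha> > 0, which holds near 1; an
    arbitrary \<open>S\<close> serves both one-sided limits.\<close>
  have ev: "\<forall>\<^sub>F \<alpha> in at 1 within S. renyi_of_densities P \<alpha> (\<lambda>_. 1) W = renyi_divergence \<alpha> P Q" for S
  proof -
    have "\<forall>\<^sub>F \<alpha> in at 1 within S. 0 < (\<alpha>::real)"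
      by (rule order_tendstoD(1)[OF tendsto_ident_at]) simp
    then show ?thesis
      by eventually_elim (simp add: renyi)
  qed
  show ?thesis
  proof (intro conjI impI)
    show "((\<lambda>\<alpha>. renyi_divergence \<alpha> P Q) \<longlongrightarrow> KL_div P Q) (at_left 1)"
      unfolding KL
      by (rule Lim_transform_eventually[OF P.tendsto_renyi_of_densities_one_left[OF W W_nonneg] ev])
    assume "KL_div P Q = \<infinity> \<or> (\<exists>\<beta>>1. renyi_divergence \<beta> P Q < \<infinity>)"
    then have "KL_of_densities P (\<lambda>_. 1) W = \<infinity> \<or> (\<exists>\<beta>>1. renyi_of_densities P \<beta> (\<lambda>_. 1) W < \<infinity>)"
      using renyi by (auto simp: KL)
    from P.tendsto_renyi_of_densities_one_right[OF W W_nonneg this]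
    show "((\<lambda>\<alpha>. renyi_divergence \<alpha> P Q) \<longlongrightarrow> KL_div P Q) (at_right 1)"
      unfolding KL by (rule Lim_transform_eventually[OF _ ev])
  qed
qed

end
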